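(* Let $K=\mathrm{GF}(2)$, let $V$ be a finite dimensional vector space over $K$, let $f:V\to V$ be a nilpotent $K$-linear map with elementary divisors $\lambda^{t_1},\dots,\lambda^{t_m}$, $0<t_1\le\cdots\le t_m$, and let $U=(u_1,\dots,u_m)$ be a generator tuple of $V$ with respect to $f$. Let $\vec\mu=(\mu_1,\dots,\mu_m)$, $\vec r=(r_1,\dots,r_m)\in\mathcal L(\vec t\,)$ and let $$J=\{i_1,\dots,i_k\}\subseteq I_u,\quad i_1<\cdots<i_k,\quad |J|\ge2.$$ If $X$ is a characteristic subspace of $V$ that is not hyperinvariant, and $J(X)=J$, $X^h=W(\vec\mu)$ and $X_H=W(\vec r)$, then $$\vec r=\vec\mu+\sum_{s=1}^k\vec e_{i_s},$$ and $\vec\mu_J=(\mu_{i_1},\dots,\mu_{i_k})$ satisfies $$0\le\mu_{i_1}<\cdots<\mu_{i_k}\quad\text{and}\quad0<t_{i_1}-\mu_{i_1}<\cdots<t_{i_k}-\mu_{i_k},$$ and $$t_{i_s}+1<t_{i_{s+1}},\quad s=1,\dots,k-1.$$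
   Context: A subspace of $V$ is hyperinvariant if it is invariant under all endomorphisms of $V$ that commute with $f$. It is characteristic if it is $f$-invariant and invariant under all automorphisms of $V$ that commute with $f$. For an $f$-invariant subspace $X$, $X_H$ (the hyperinvariant kernel) is the largest hyperinvariant subspace contained in $X$, and $X^h$ (the hyperinvariant hull) is the smallest hyperinvariant subspace containing $X$. For $x\in V$, $\langle x\rangle=\mathrm{span}\{f^ix:\ i\ge0\}$, and the exponent $\mathrm e(x)$ is the smallest integer $\ell\ge0$ with $f^\ell x=0$. A generator tuple is a tuple $U=(u_1,\dots,u_m)$ of elements of $V$ with $V=\langle u_1\rangle\oplus\cdots\oplus\langle u_m\rangle$ and $\mathrm e(u_j)=t_j$ for $j=1,\dots,m$. $\pi_j:V\to V$ is the projection onto $\langle u_j\rangle$ along $\bigoplus_{i\ne j}\langle u_i\rangle$. For a characteristic subspace $X$, $J(X)=\{j:\ \langle u_j\rangle\cap X\subsetneqq\pi_jX\}$. $I_u=\{i:\ t_i\ne t_k\text{ for all }k\ne i,\ 1\le k\le m\}$ is the set of indices of unrepeated exponents. $\vec t=(t_1,\dots,t_m)$, and $\mathcal L(\vec t\,)$ is the set of integer $m$-tuples $\vec r=(r_1,\dots,r_m)$ with $0\le r_1\le\cdots\le r_m$ and $0\le t_1-r_1\le\cdots\le t_m-r_m$. For $\vec r\in\mathcal L(\vec t\,)$, $W(\vec r)=\sum_{j=1}^m\big(f^{r_j}V\cap\mathrm{Ker}f^{t_j-r_j}\big)$. It is known that $W(\vec r)=\langle f^{r_1}u_1\rangle\oplus\cdots\oplus\langle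 f^{r_m}u_m\rangle$ for every generator tuple, and that $\vec r\mapsto W(\vec r)$ is a bijection from $\mathcal L(\vec t\,)$ onto the set of hyperinvariant subspaces. $\vec e_1,\dots,\vec e_m$ are the standard unit row vectors of size $m$. *)

theory Defs
  imports Complex_Main "HOL-Library.Z2" "HOL-Library.Set_Algebras"
    "HOL-Computational_Algebra.Polynomial"
begin

text \<open>
  An \<open>m\<close>-tuple is a function on \<^typ>\<open>nat\<close> of which only the values at \<open>1, \<dots>, m\<close> matter.
  The vector space is the whole type \<open>'b\<close>. Sums of subspaces are sums of sets in the sense of
  \<^theory>\<open>HOL-Library.Set_Algebras\<close>.
\<close>

definition unit_tuple :: "nat \<Rightarrow> nat \<Rightarrow> nat" where
  "unit_tuple i = (\<lambda>j. if j = i then 1 else 0)"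

definition nilpotent_map :: "('b::zero \<Rightarrow> 'b) \<Rightarrow> bool" where
  "nilpotent_map f \<longleftrightarrow> (\<exists>n. \<forall>x. (f ^^ n) x = 0)"

text \<open>Meaningful when some power of \<open>f\<close> annihilates \<open>x\<close>, in particular for nilpotent \<open>f\<close>.\<close>

definition exponent :: "('b::zero \<Rightarrow> 'b) \<Rightarrow> 'b \<Rightarrow> nat" where
  "exponent f x = (LEAST l. (f ^^ l) x = 0)"

definition whole_direct_sum :: "nat \<Rightarrow> (nat \<Rightarrow> 'b::comm_monoid_add set) \<Rightarrow> bool" where
  "whole_direct_sum m A \<longleftrightarrow>
     (\<Sum>j\<in>{1..m}. A j) = UNIV \<and>
     (\<forall>x. (\<forall>j\<in>{1..m}. x j \<in> A j) \<and> (\<Sum>j\<in>{1..m}. x j) = 0 \<longrightarrow> (\<forall>j\<in>{1..m}. x j = 0))"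

text \<open>The projection onto \<open>A\<close> along \<open>B\<close>, for complementary subspaces \<open>A\<close> and \<open>B\<close>.\<close>

definition proj_along :: "'b::ab_group_add set \<Rightarrow> 'b set \<Rightarrow> 'b \<Rightarrow> 'b" where
  "proj_along A B x = (THE y. y \<in> A \<and> x - y \<in> B)"

definition unrepeated :: "nat \<Rightarrow> (nat \<Rightarrow> nat) \<Rightarrow> nat set" where
  "unrepeated m t = {i \<in> {1..m}. \<forall>k\<in>{1..m}. k \<noteq> i \<longrightarrow> t i \<noteq> t k}"

text \<open>
  The entries of the tuples are automatically nonnegative, so they are taken in \<^typ>\<open>nat\<close>.
  The inequalities \<open>r j \<le> t j\<close> are \<open>0 \<le> t j - r j\<close> and make the truncated differences genuine.
\<close>

definition tuple_lattice :: "nat \<Rightarrow> (nat \<Rightarrow> nat) \<Rightarrow> (nat \<Rightarrow> nat) set" where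
  "tuple_lattice m t =
     {r. (\<forall>j\<in>{1..m}. r j \<le> t j) \<and>
         (\<forall>j\<in>{1..<m}. r j \<le> r (Suc j) \<and> t j - r j \<le> t (Suc j) - r (Suc j))}"

definition W :: "('b::ab_group_add \<Rightarrow> 'b) \<Rightarrow> nat \<Rightarrow> (nat \<Rightarrow> nat) \<Rightarrow> (nat \<Rightarrow> nat) \<Rightarrow> 'b set" where
  "W f m t r = (\<Sum>j\<in>{1..m}. range (f ^^ r j) \<inter> {x. (f ^^ (t j - r j)) x = 0})"

definition endomorphism ::
  "('a::field \<Rightarrow> 'b::ab_group_add \<Rightarrow> 'b) \<Rightarrow> ('b \<Rightarrow> 'b) \<Rightarrow> bool" where
  "endomorphism scale g \<longleftrightarrow> Vector_Spaces.linear scale scale g"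

definition automorphism ::
  "('a::field \<Rightarrow> 'b::ab_group_add \<Rightarrow> 'b) \<Rightarrow> ('b \<Rightarrow> 'b) \<Rightarrow> bool" where
  "automorphism scale g \<longleftrightarrow> endomorphism scale g \<and> bij g"

definition hyperinvariant ::
  "('a::field \<Rightarrow> 'b::ab_group_add \<Rightarrow> 'b) \<Rightarrow> ('b \<Rightarrow> 'b) \<Rightarrow> 'b set \<Rightarrow> bool" where
  "hyperinvariant scale f X \<longleftrightarrow>
     module.subspace scale X \<and> (\<forall>g. endomorphism scale g \<and> g \<circ> f = f \<circ> g \<longrightarrow> g ` X \<subseteq> X)"

definition characteristic ::
  "('a::field \<Rightarrow> 'b::ab_group_add \<Rightarrow> 'b) \<Rightarrow> ('b \<Rightarrow> 'b) \<Rightarrow> 'b set \<Rightarrow> bool" where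
  "characteristic scale f X \<longleftrightarrow>
     module.subspace scale X \<and> f ` X \<subseteq> X \<and> (\<forall>g. automorphism scale g \<and> g \<circ> f = f \<circ> g \<longrightarrow> g ` X \<subseteq> X)"

definition hyperinvariant_kernel ::
  "('a::field \<Rightarrow> 'b::ab_group_add \<Rightarrow> 'b) \<Rightarrow> ('b \<Rightarrow> 'b) \<Rightarrow> 'b set \<Rightarrow> 'b set" where
  "hyperinvariant_kernel scale f X = (GREATEST Y. hyperinvariant scale f Y \<and> Y \<subseteq> X)"

definition hyperinvariant_hull ::
  "('a::field \<Rightarrow> 'b::ab_group_add \<Rightarrow> 'b) \<Rightarrow> ('b \<Rightarrow> 'b) \<Rightarrow> 'b set \<Rightarrow> 'b set" where
  "hyperinvariant_hull scale f X = (LEAST Y. hyperinvariant scale f Y \<and> X \<subseteq> Y)"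

definition cyclic ::
  "('a::field \<Rightarrow> 'b::ab_group_add \<Rightarrow> 'b) \<Rightarrow> ('b \<Rightarrow> 'b) \<Rightarrow> 'b \<Rightarrow> 'b set" where
  "cyclic scale f x = module.span scale (range (\<lambda>i. (f ^^ i) x))"

definition poly_act ::
  "('a::field \<Rightarrow> 'b::ab_group_add \<Rightarrow> 'b) \<Rightarrow> ('b \<Rightarrow> 'b) \<Rightarrow> 'a poly \<Rightarrow> 'b \<Rightarrow> 'b" where
  "poly_act scale f p x = (\<Sum>i\<le>degree p. scale (coeff p i) ((f ^^ i) x))"

text \<open>
  The elementary divisors of \<open>f\<close>: the space, as a module over the polynomial ring, is a direct sum
  of cyclic modules whose annihilators are generated by powers \<open>d 1, \<dots>, d m\<close> of monic irreducible
  polynomials.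
\<close>

definition elementary_divisors ::
  "('a::field \<Rightarrow> 'b::ab_group_add \<Rightarrow> 'b) \<Rightarrow> ('b \<Rightarrow> 'b) \<Rightarrow> nat \<Rightarrow> (nat \<Rightarrow> 'a poly) \<Rightarrow> bool" where
  "elementary_divisors scale f m d \<longleftrightarrow>
     (\<forall>j\<in>{1..m}. \<exists>p n. irreducible p \<and> lead_coeff p = 1 \<and> 0 < n \<and> d j = p ^ n) \<and>
     (\<exists>v. whole_direct_sum m (\<lambda>j. cyclic scale f (v j)) \<and>
          (\<forall>j\<in>{1..m}. {p. poly_act scale f p (v j) = 0} = {p. d j dvd p}))"

definition generator_tuple ::
  "('a::field \<Rightarrow> 'b::ab_group_add \<Rightarrow> 'b) \<Rightarrow> ('b \<Rightarrow> 'b) \<Rightarrow> nat \<Rightarrow> (nat \<Rightarrow> nat) \<Rightarrow> (nat \<Rightarrow> 'b) \<Rightarrow> bool" where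
  "generator_tuple scale f m t u \<longleftrightarrow>
     whole_direct_sum m (\<lambda>j. cyclic scale f (u j)) \<and> (\<forall>j\<in>{1..m}. exponent f (u j) = t j)"

definition gen_proj ::
  "('a::field \<Rightarrow> 'b::ab_group_add \<Rightarrow> 'b) \<Rightarrow> ('b \<Rightarrow> 'b) \<Rightarrow> nat \<Rightarrow> (nat \<Rightarrow> 'b) \<Rightarrow> nat \<Rightarrow> 'b \<Rightarrow> 'b" where
  "gen_proj scale f m u j = proj_along (cyclic scale f (u j)) (\<Sum>i\<in>{1..m} - {j}. cyclic scale f (u i))"

definition J_set ::
  "('a::field \<Rightarrow> 'b::ab_group_add \<Rightarrow> 'b) \<Rightarrow> ('b \<Rightarrow> 'b) \<Rightarrow> nat \<Rightarrow> (nat \<Rightarrow> 'b) \<Rightarrow> 'b set \<Rightarrow> nat set" where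
  "J_set scale f m u X = {j \<in> {1..m}. cyclic scale f (u j) \<inter> X \<subset> gen_proj scale f m u j ` X}"

end

(*
  If h commutes with f and is nilpotent, then 1 + h is an automorphism commuting with f, so a
  characteristic subspace X is invariant under h. Take h = pi_i g pi_j with i ~= j, and h = f pi_j.
  The first choice shows that the hyperinvariant kernel and hull of X are the direct sums of the
  intersections of X with <u_j> and of the pi_j X, so these components are generated by f^{r_j} u_j
  and f^{mu_j} u_j; the second gives r_j <= mu_j + 1, with equality exactly for j in J(X).
  For i ~= j, a map g commuting with f that sends u_j to f^{max(t_i - t_j, 0)} u_i, applied to an
  element of X whose j-th component is f^{mu_j} u_j, yields r_i <= mu_j + max(t_i - t_j, 0).
  For two elements of J(X) these bounds are the asserted strict inequalities.
*)

theory Submission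
  imports Defs
begin

section \<open>Endomorphisms commuting with a nilpotent map\<close>

locale nilpotent_space = finite_dimensional_vector_space scale Basis
  for scale :: "'a::field \<Rightarrow> 'b::ab_group_add \<Rightarrow> 'b" (infixr "*s" 75) and Basis +
  fixes f :: "'b \<Rightarrow> 'b"
  assumes linear_f: "Vector_Spaces.linear scale scale f"
    and nilpotent_f: "nilpotent_map f"
begin

interpretation self: vector_space_pair scale scale ..

abbreviation cyc :: "'b \<Rightarrow> 'b set" where
  "cyc \<equiv> cyclic scale f"

text \<open>The commutant of \<open>f\<close>, named because its closure under composition and
  powers is used throughout.\<close>

definition centralizes :: "('b \<Rightarrow> 'b) \<Rightarrow> bool" where
  "centralizes g \<longleftrightarrow> endomorphism scale g \<and> g \<circ> f = f \<circ> g"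

lemma centralizes_linear: "centralizes g \<Longrightarrow> Vector_Spaces.linear scale scale g"
  by (simp add: centralizes_def endomorphism_def)

lemma
  assumes "centralizes g"
  shows centralizes_add: "g (x + y) = g x + g y"
    and centralizes_diff: "g (x - y) = g x - g y"
    and centralizes_scale: "g (c *s x) = c *s g x"
    and centralizes_zero: "g 0 = 0"
    and centralizes_sum: "g (sum h A) = (\<Sum>a\<in>A. g (h a))"
    and centralizes_f: "g (f x) = f (g x)"
  using centralizes_linear[OF assms] assms
  by (auto simp: self.linear_add self.linear_diff self.linear_scale self.linear_0 self.linear_sum
      centralizes_def fun_eq_iff)

lemma centralizesI:
  assumes "\<And>x y. g (x + y) = g x + g y" "\<And>c x. g (c *s x) = c *s g x" "\<And>x. g (f x) = f (g x)"
  shows "centralizes g"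
  using assms
  by (auto simp: centralizes_def endomorphism_def fun_eq_iff vector_space_axioms
      Vector_Spaces.linear_iff)

lemma centralizes_self: "centralizes f"
  by (simp add: centralizes_def endomorphism_def linear_f)

lemma centralizes_comp: "centralizes g \<Longrightarrow> centralizes h \<Longrightarrow> centralizes (g \<circ> h)"
  by (intro centralizesI) (simp_all add: centralizes_add centralizes_scale centralizes_f)

lemma centralizes_funpow: "centralizes g \<Longrightarrow> centralizes (g ^^ n)"
proof (induction n)
  case 0
  show ?case by (intro centralizesI) simp_all
next
  case (Suc n)
  then show ?case unfolding funpow.simps using centralizes_comp by blast
qed

lemma centralizes_funpow_f: "centralizes g \<Longrightarrow> g ((f ^^ n) x) = (f ^^ n) (g x)"
  by (induction n) (simp_all add: centralizes_f)

lemmas fpow_add = centralizes_add[OF centralizes_funpow[OF centralizes_self]]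
lemmas fpow_scale = centralizes_scale[OF centralizes_funpow[OF centralizes_self]]
lemmas fpow_zero = centralizes_zero[OF centralizes_funpow[OF centralizes_self]]

lemma fpow_fpow: "(f ^^ a) ((f ^^ b) x) = (f ^^ (a + b)) x"
  by (simp add: funpow_add)

section \<open>Cyclic subspaces and the chain of powers of a generator\<close>

lemma subspace_cyc: "subspace (cyc x)"
  by (simp add: cyclic_def)

lemma fpow_in_cyc: "(f ^^ n) x \<in> cyc x"
  by (auto simp: cyclic_def intro: span_base)

lemma cyc_minimal:
  assumes "subspace S" "\<And>n. (f ^^ n) x \<in> S"
  shows "cyc x \<subseteq> S"
  unfolding cyclic_def using assms by (intro span_minimal) auto

lemma f_in_cyc: "y \<in> cyc x \<Longrightarrow> f y \<in> cyc x"
proof -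
  have "subspace {y. f y \<in> cyc x}"
    by (intro subspaceI)
      (auto simp: centralizes_add[OF centralizes_self] centralizes_scale[OF centralizes_self]
        centralizes_zero[OF centralizes_self]
        intro: subspace_add subspace_scale subspace_0 subspace_cyc)
  then have "cyc x \<subseteq> {y. f y \<in> cyc x}"
    using fpow_in_cyc[of "Suc _"] by (intro cyc_minimal) auto
  then show "y \<in> cyc x \<Longrightarrow> f y \<in> cyc x" by blast
qed

lemma fpow_cyc: "y \<in> cyc x \<Longrightarrow> (f ^^ n) y \<in> cyc x"
  by (induction n) (simp_all add: f_in_cyc)

lemma cyc_subset: "y \<in> cyc x \<Longrightarrow> cyc y \<subseteq> cyc x"
  by (simp add: cyc_minimal subspace_cyc fpow_cyc)

lemma cyc_fpow_mono: "r \<le> n \<Longrightarrow> cyc ((f ^^ n) x) \<subseteq> cyc ((f ^^ r) x)"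
  by (metis cyc_subset fpow_in_cyc fpow_fpow le_add_diff_inverse2)

lemma cyc_funpow_eq_0:
  assumes "y \<in> cyc x" "(f ^^ n) x = 0"
  shows "(f ^^ n) y = 0"
proof -
  have "subspace {y. (f ^^ n) y = 0}"
    by (intro subspaceI) (auto simp: fpow_add fpow_scale fpow_zero)
  moreover have "(f ^^ n) ((f ^^ k) x) = 0" for k
    using assms(2) by (metis add.commute fpow_fpow fpow_zero)
  ultimately have "cyc x \<subseteq> {y. (f ^^ n) y = 0}"
    by (intro cyc_minimal) auto
  with assms(1) show ?thesis by blast
qed

lemma fpow_exponent: "(f ^^ exponent f x) x = 0"
proof -
  obtain n where "(f ^^ n) x = 0" using nilpotent_f unfolding nilpotent_map_def by blast
  then show ?thesis unfolding exponent_def by (rule LeastI)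
qed

lemma fpow_eq_0_iff: "(f ^^ n) x = 0 \<longleftrightarrow> exponent f x \<le> n"
proof
  show "(f ^^ n) x = 0 \<Longrightarrow> exponent f x \<le> n"
    unfolding exponent_def by (rule Least_le)
  show "(f ^^ n) x = 0" if "exponent f x \<le> n"
    using that fpow_exponent[of x] by (metis fpow_fpow fpow_zero le_add_diff_inverse2)
qed

text \<open>With \<open>e\<close> the exponent of \<open>x\<close>, the power \<open>e - r\<close>
  of \<open>f\<close> kills \<open>cyc ((f ^^ r) x)\<close> and hence \<open>(f ^^ n) x\<close>, so
  \<open>e \<le> e - r + n\<close>. For \<open>r > e\<close> the cyclic subspace would be 0 and
  contain \<open>(f ^^ e) x\<close>, hence the bound on \<open>r\<close>.\<close>

lemma fpow_in_cyc_fpow: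
  assumes "(f ^^ n) x \<in> cyc ((f ^^ r) x)" "r \<le> exponent f x"
  shows "r \<le> n"
proof -
  have "(f ^^ (exponent f x - r)) ((f ^^ r) x) = 0"
    by (simp add: fpow_fpow fpow_exponent assms(2))
  then have "(f ^^ (exponent f x - r)) ((f ^^ n) x) = 0"
    by (rule cyc_funpow_eq_0[OF assms(1)])
  then have "exponent f x \<le> exponent f x - r + n"
    by (simp add: fpow_fpow fpow_eq_0_iff)
  with assms(2) show ?thesis by linarith
qed

text \<open>The spanning powers of \<open>x\<close> are \<open>x\<close> followed by those of
  \<open>f x\<close>. This plays the role of splitting the constant term off a polynomial.\<close>

lemma cyc_split:
  assumes "y \<in> cyc x"
  obtains c z where "z \<in> cyc (f x)" "y = c *s x + z"
proof -
  have eq: "cyc x = span (insert x (range (\<lambda>i. (f ^^ i) (f x))))"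
  proof -
    have "range (\<lambda>i. (f ^^ i) x) = insert x (range (\<lambda>i. (f ^^ Suc i) x))"
    proof (intro equalityI subsetI)
      fix y assume "y \<in> range (\<lambda>i. (f ^^ i) x)"
      then obtain n where "y = (f ^^ n) x" by blast
      then show "y \<in> insert x (range (\<lambda>i. (f ^^ Suc i) x))" by (cases n) auto
    next
      fix y assume "y \<in> insert x (range (\<lambda>i. (f ^^ Suc i) x))"
      then show "y \<in> range (\<lambda>i. (f ^^ i) x)"
        by (metis (no_types, lifting) funpow_0 imageE insertE rangeI)
    qed
    then show ?thesis by (simp add: cyclic_def funpow_swap1)
  qed
  from assms obtain c where "y - c *s x \<in> cyc (f x)"
    unfolding eq span_breakdown_eq by (auto simp: cyclic_def)
  then show thesis using that[of "y - c *s x" c] by simp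
qed

text \<open>Raising \<open>r\<close> by one splits off a multiple of \<open>(f ^^ r) x\<close>; its
  coefficient has to vanish because the power of \<open>f\<close> one below the exponent does not
  annihilate \<open>x\<close>.\<close>

lemma kernel_fpow_in_cyc:
  assumes "y \<in> cyc x" "r \<le> exponent f x" "(f ^^ (exponent f x - r)) y = 0"
  shows "y \<in> cyc ((f ^^ r) x)"
  using assms(2,3)
proof (induction r)
  case 0
  then show ?case using assms(1) by simp
next
  case (Suc r)
  let ?e = "exponent f x"
  have e: "?e - r = Suc (?e - Suc r)" using Suc.prems by simp
  have "(f ^^ (?e - r)) y = 0"
    unfolding e using Suc.prems(2) by (simp add: centralizes_zero[OF centralizes_self])
  then have "y \<in> cyc ((f ^^ r) x)" using Suc by simp
  then obtain c z where z: "z \<in> cyc (f ((f ^^ r) x))" and y: "y = c *s (f ^^ r) x + z"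
    by (rule cyc_split)
  have "(f ^^ (?e - Suc r)) (f ((f ^^ r) x)) = 0"
    using fpow_fpow[of "?e - Suc r" "Suc r" x] Suc.prems(1) fpow_exponent[of x] by simp
  then have "(f ^^ (?e - Suc r)) z = 0" using z cyc_funpow_eq_0 by blast
  \<comment> \<open>Applied to \<open>y\<close>, the power \<open>?e - Suc r\<close> kills
    \<open>z\<close> and raises \<open>(f ^^ r) x\<close> to the power
    \<open>?e - 1\<close>.\<close>
  then have "c *s (f ^^ (?e - 1)) x = 0"
    using Suc.prems by (simp add: y fpow_add fpow_scale fpow_fpow)
  moreover have "(f ^^ (?e - 1)) x \<noteq> 0" using Suc.prems(1) by (simp add: fpow_eq_0_iff)
  ultimately have "c = 0" by simp
  with y z show ?case by simp
qed

section \<open>Polynomials in \<open>f\<close>, represented by the double commutant\<close>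

definition bicentralizes :: "('b \<Rightarrow> 'b) \<Rightarrow> bool" where
  "bicentralizes q \<longleftrightarrow> centralizes q \<and> (\<forall>g y. centralizes g \<longrightarrow> g (q y) = q (g y))"

lemma
  assumes "bicentralizes q"
  shows bicentralizes_centralizes: "centralizes q"
    and bicentralizes_commute: "centralizes g \<Longrightarrow> g (q y) = q (g y)"
  using assms by (auto simp: bicentralizes_def)

lemma bicentralizes_zero: "bicentralizes (\<lambda>_. 0)"
  by (auto simp: bicentralizes_def centralizes_zero centralizes_zero[OF centralizes_self]
      intro!: centralizesI)

lemma bicentralizes_fpow: "bicentralizes (f ^^ n)"
  by (simp add: bicentralizes_def centralizes_funpow[OF centralizes_self] centralizes_funpow_f)

lemma bicentralizes_add:
  assumes "bicentralizes p" "bicentralizes q"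
  shows "bicentralizes (\<lambda>y. p y + q y)"
  unfolding bicentralizes_def
proof (intro conjI allI impI)
  show "centralizes (\<lambda>y. p y + q y)"
    using assms[THEN bicentralizes_centralizes]
    by (intro centralizesI)
      (simp_all add: centralizes_add centralizes_scale centralizes_f scale_right_distrib
        centralizes_add[OF centralizes_self])
  show "g (p y + q y) = p (g y) + q (g y)" if "centralizes g" for g y
    using assms[THEN bicentralizes_commute, OF that] by (simp add: centralizes_add[OF that])
qed

lemma bicentralizes_scale:
  assumes "bicentralizes p"
  shows "bicentralizes (\<lambda>y. c *s p y)"
  unfolding bicentralizes_def
proof (intro conjI allI impI)
  show "centralizes (\<lambda>y. c *s p y)"
    using assms[THEN bicentralizes_centralizes]
    by (intro centralizesI)
      (simp_all add: centralizes_add centralizes_scale centralizes_f scale_right_distrib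
        centralizes_scale[OF centralizes_self] scale_left_commute)
  show "g (c *s p y) = c *s p (g y)" if "centralizes g" for g y
    using assms[THEN bicentralizes_commute, OF that] by (simp add: centralizes_scale[OF that])
qed

text \<open>Every element of \<open>cyc x\<close> is the value at \<open>x\<close> of a polynomial
  in \<open>f\<close>. In place of the polynomial only the properties used later are recorded:
  \<open>q\<close> commutes with the whole commutant of \<open>f\<close> and maps each vector into
  its own cyclic subspace. They survive sums and scalar multiples, so a span argument
  suffices.\<close>

lemma cyc_endomorphism:
  assumes "z \<in> cyc x"
  obtains q where "z = q x" "bicentralizes q" "\<forall>y. q y \<in> cyc y"
proof -
  let ?S = "{z. \<exists>q. z = q x \<and> bicentralizes q \<and> (\<forall>y. q y \<in> cyc y)}"
  have SI: "q x \<in> ?S" if "bicentralizes q" "\<And>y. q y \<in> cyc y" for q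
    using that by blast
  have "subspace ?S"
  proof (rule subspaceI)
    show "0 \<in> ?S"
      by (rule SI[OF bicentralizes_zero]) (rule subspace_0[OF subspace_cyc])
  next
    fix v w assume "v \<in> ?S" "w \<in> ?S"
    then obtain p q where p: "v = p x" "bicentralizes p" "\<forall>y. p y \<in> cyc y"
      and q: "w = q x" "bicentralizes q" "\<forall>y. q y \<in> cyc y" by blast
    show "v + w \<in> ?S"
      unfolding p(1) q(1)
      by (rule SI[OF bicentralizes_add[OF p(2) q(2)]])
        (use p(3) q(3) subspace_add[OF subspace_cyc] in blast)
  next
    fix c v assume "v \<in> ?S"
    then obtain p where p: "v = p x" "bicentralizes p" "\<forall>y. p y \<in> cyc y" by blast
    show "c *s v \<in> ?S"
      unfolding p(1)
      by (rule SI[OF bicentralizes_scale[OF p(2)]])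
        (use p(3) subspace_scale[OF subspace_cyc] in blast)
  qed
  moreover have "(f ^^ n) x \<in> ?S" for n
    by (rule SI[OF bicentralizes_fpow fpow_in_cyc])
  ultimately have "cyc x \<subseteq> ?S" by (rule cyc_minimal)
  then have "z \<in> ?S" using assms by blast
  then show thesis using that by blast
qed

text \<open>With \<open>y = p x\<close> and \<open>h x = q x\<close> for polynomials
  \<open>p\<close>, \<open>q\<close> in \<open>f\<close>, one gets
  \<open>h y = p (h x) = p (q x) = q y\<close>. So \<open>h\<close> acts on \<open>cyc x\<close>
  like a polynomial in \<open>f\<close>.\<close>

lemma cyclic_endomorphism_image:
  assumes "y \<in> cyc x" "centralizes h" "h x \<in> cyc x"
  shows "h y \<in> cyc y"
proof -
  obtain p where p: "y = p x" "bicentralizes p" "\<forall>y. p y \<in> cyc y"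
    using cyc_endomorphism[OF assms(1)] .
  obtain q where q: "h x = q x" "bicentralizes q" "\<forall>y. q y \<in> cyc y"
    using cyc_endomorphism[OF assms(3)] .
  have "h y = p (q x)" using bicentralizes_commute[OF p(2) assms(2), of x] by (simp add: p(1) q(1))
  also have "\<dots> = q y"
    using bicentralizes_commute[OF q(2) bicentralizes_centralizes[OF p(2)], of x] by (simp add: p(1))
  finally show ?thesis using q(3) by simp
qed

text \<open>Since \<open>1 + h\<close> is injective by nilpotency and bijective by finite dimension,
  it preserves \<open>X\<close>, and \<open>h x = (1 + h) x - x\<close>.\<close>

lemma characteristic_nilpotent_image:
  assumes X: "characteristic scale f X" and h: "centralizes h"
    and nil: "\<And>x. (h ^^ n) x = 0" and x: "x \<in> X"
  shows "h x \<in> X"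
proof -
  let ?g = "\<lambda>x. x + h x"
  have g: "centralizes ?g"
    using h by (intro centralizesI)
      (simp_all add: centralizes_add centralizes_scale centralizes_f scale_right_distrib
        centralizes_add[OF centralizes_self])
  have "x = 0" if "x + h x = 0" for x
  proof -
    have "(h ^^ k) x = 0 \<Longrightarrow> x = 0" for k
    proof (induction k)
      case (Suc k)
      \<comment> \<open>Here \<open>h\<close> acts on \<open>x\<close> as -1, so the vanishing of
        one power of \<open>h\<close> at \<open>x\<close> passes down to the preceding
        power.\<close>
      have "h x = 0 - x" using that by (simp add: eq_neg_iff_add_eq_0 add.commute)
      then have "0 = (h ^^ k) (0 - x)" using Suc.prems by (simp add: funpow_swap1)
      also have "\<dots> = 0 - (h ^^ k) x"
        by (simp only: centralizes_diff[OF centralizes_funpow[OF h]]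
            centralizes_zero[OF centralizes_funpow[OF h]])
      finally show ?case using Suc.IH by simp
    qed simp
    then show ?thesis using nil by blast
  qed
  then have "inj ?g"
    unfolding self.linear_inj_iff_eq_0[OF centralizes_linear[OF g]] by blast
  then have "bij ?g"
    using linear_inj_imp_surj[OF centralizes_linear[OF g]] by (simp add: bij_def)
  then have "?g x \<in> X"
    using X g x unfolding characteristic_def automorphism_def centralizes_def
    by (metis image_subset_iff)
  then show ?thesis
    using X x subspace_diff[of X "?g x" x] unfolding characteristic_def by simp
qed

end

section \<open>The decomposition given by a generator tuple and its projections\<close>

locale generated_space = nilpotent_space scale Basis f
  for scale :: "'a::field \<Rightarrow> 'b::ab_group_add \<Rightarrow> 'b" (infixr "*s" 75) and Basis f +
  fixes m :: nat and t :: "nat \<Rightarrow> nat" and u :: "nat \<Rightarrow> 'b"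
  assumes generator_tuple: "generator_tuple scale f m t u"
begin

interpretation self: vector_space_pair scale scale ..

abbreviation proj :: "nat \<Rightarrow> 'b \<Rightarrow> 'b" where
  "proj \<equiv> gen_proj scale f m u"

lemma exponent_u: "j \<in> {1..m} \<Longrightarrow> exponent f (u j) = t j"
  using generator_tuple by (simp add: generator_tuple_def)

lemma fpow_u_eq_0: "j \<in> {1..m} \<Longrightarrow> t j \<le> n \<Longrightarrow> (f ^^ n) (u j) = 0"
  by (simp add: fpow_eq_0_iff exponent_u)

lemma decomposition_exists:
  obtains v where "\<forall>j\<in>{1..m}. v j \<in> cyc (u j)" "x = (\<Sum>j\<in>{1..m}. v j)"
proof -
  have "x \<in> (\<Sum>j\<in>{1..m}. cyc (u j))"
    using generator_tuple by (simp add: generator_tuple_def whole_direct_sum_def)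
  then show thesis using that by (auto simp: set_sum_alt)
qed

lemma decomposition_unique:
  assumes "\<And>j. j \<in> {1..m} \<Longrightarrow> v j \<in> cyc (u j)" "\<And>j. j \<in> {1..m} \<Longrightarrow> w j \<in> cyc (u j)"
    and "(\<Sum>j\<in>{1..m}. v j) = (\<Sum>j\<in>{1..m}. w j)" and "j \<in> {1..m}"
  shows "v j = w j"
proof -
  have "(\<forall>j\<in>{1..m}. v j - w j \<in> cyc (u j)) \<and> (\<Sum>j\<in>{1..m}. v j - w j) = 0"
    using assms by (auto simp: sum_subtractf intro: subspace_diff[OF subspace_cyc])
  then have "v j - w j = 0"
    using generator_tuple assms(4) unfolding generator_tuple_def whole_direct_sum_def
    by (elim conjE allE[of _ "\<lambda>j. v j - w j"]) blast
  then show ?thesis by simp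
qed

lemma proj_sum:
  assumes v: "\<And>j. j \<in> {1..m} \<Longrightarrow> v j \<in> cyc (u j)" and j: "j \<in> {1..m}"
  shows "proj j (\<Sum>i\<in>{1..m}. v i) = v j"
  unfolding gen_proj_def proj_along_def
proof (rule the_equality)
  have "(\<Sum>i\<in>{1..m}. v i) - v j = (\<Sum>i\<in>{1..m} - {j}. v i)"
    using j by (simp add: sum_diff1)
  then show "v j \<in> cyc (u j) \<and> (\<Sum>i\<in>{1..m}. v i) - v j \<in> (\<Sum>i\<in>{1..m} - {j}. cyc (u i))"
    using v j by (auto simp: set_sum_alt)
next
  fix y assume y: "y \<in> cyc (u j) \<and> (\<Sum>i\<in>{1..m}. v i) - y \<in> (\<Sum>i\<in>{1..m} - {j}. cyc (u i))"
  then obtain w where w: "(\<Sum>i\<in>{1..m}. v i) - y = sum w ({1..m} - {j})"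
      "\<And>i. i \<in> {1..m} - {j} \<Longrightarrow> w i \<in> cyc (u i)"
    by (auto simp: set_sum_alt)
  \<comment> \<open>Inserting the competing value \<open>y\<close> as the \<open>j\<close>-th entry
    gives a full decomposition, to which uniqueness applies.\<close>
  have "(\<Sum>i\<in>{1..m}. (w(j := y)) i) = y + sum w ({1..m} - {j})"
    using j by (simp add: sum.remove[of _ j])
  then have "(\<Sum>i\<in>{1..m}. v i) = (\<Sum>i\<in>{1..m}. (w(j := y)) i)"
    using w(1) by (simp add: algebra_simps)
  then have "v j = (w(j := y)) j"
    using v w(2) y j by (intro decomposition_unique[of v "w(j := y)"]) auto
  then show "y = v j" by simp
qed

lemma
  shows proj_in_cyc: "j \<in> {1..m} \<Longrightarrow> proj j x \<in> cyc (u j)"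
    and sum_proj: "(\<Sum>j\<in>{1..m}. proj j x) = x"
proof -
  obtain v where v: "\<forall>j\<in>{1..m}. v j \<in> cyc (u j)" "x = (\<Sum>j\<in>{1..m}. v j)"
    using decomposition_exists[of x] .
  have proj_v: "proj i x = v i" if "i \<in> {1..m}" for i
    unfolding v(2) using v(1) that by (intro proj_sum) blast+
  then show "j \<in> {1..m} \<Longrightarrow> proj j x \<in> cyc (u j)" using v(1) by simp
  have "(\<Sum>j\<in>{1..m}. proj j x) = (\<Sum>j\<in>{1..m}. v j)" by (intro sum.cong refl proj_v)
  then show "(\<Sum>j\<in>{1..m}. proj j x) = x" by (simp only: v(2))
qed

lemma proj_component:
  assumes "i \<in> {1..m}" "x \<in> cyc (u i)" "j \<in> {1..m}"
  shows "proj j x = (if j = i then x else 0)"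
proof -
  have "proj j (\<Sum>l\<in>{1..m}. if l = i then x else 0) = (if j = i then x else 0)"
    using assms by (intro proj_sum) (auto intro: subspace_0[OF subspace_cyc])
  then show ?thesis using assms(1) by simp
qed

lemma centralizes_proj:
  assumes j: "j \<in> {1..m}"
  shows "centralizes (proj j)"
proof (rule centralizesI)
  note P = subspace_add[OF subspace_cyc] subspace_scale[OF subspace_cyc] proj_in_cyc f_in_cyc
  show "proj j (x + y) = proj j x + proj j y" for x y
  proof -
    have "x + y = (\<Sum>i\<in>{1..m}. proj i x + proj i y)" by (simp only: sum.distrib sum_proj)
    then show ?thesis using proj_sum[of "\<lambda>i. proj i x + proj i y" j] P j by simp
  qed
  show "proj j (c *s x) = c *s proj j x" for c x
  proof -
    have "c *s x = (\<Sum>i\<in>{1..m}. c *s proj i x)" by (simp only: scale_sum_right[symmetric] sum_proj)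
    then show ?thesis using proj_sum[of "\<lambda>i. c *s proj i x" j] P j by simp
  qed
  show "proj j (f x) = f (proj j x)" for x
  proof -
    have "f x = (\<Sum>i\<in>{1..m}. f (proj i x))"
      by (simp only: centralizes_sum[OF centralizes_self, symmetric] sum_proj)
    then show ?thesis using proj_sum[of "\<lambda>i. f (proj i x)" j] P j by simp
  qed
qed

section \<open>Subspaces that are direct sums of their components\<close>

lemma mem_sum_iff:
  assumes "\<And>j. j \<in> {1..m} \<Longrightarrow> A j \<subseteq> cyc (u j)"
  shows "x \<in> (\<Sum>j\<in>{1..m}. A j) \<longleftrightarrow> (\<forall>j\<in>{1..m}. proj j x \<in> A j)"
proof
  assume "x \<in> (\<Sum>j\<in>{1..m}. A j)"
  then obtain v where v: "x = sum v {1..m}" "\<And>j. j \<in> {1..m} \<Longrightarrow> v j \<in> A j"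
    by (auto simp: set_sum_alt)
  show "\<forall>j\<in>{1..m}. proj j x \<in> A j"
  proof
    fix j assume "j \<in> {1..m}"
    then have "proj j x = v j"
      unfolding v(1) using v(2) assms by (intro proj_sum) blast+
    then show "proj j x \<in> A j" using v(2) \<open>j \<in> {1..m}\<close> by simp
  qed
next
  assume "\<forall>j\<in>{1..m}. proj j x \<in> A j"
  then show "x \<in> (\<Sum>j\<in>{1..m}. A j)"
    by (subst sum_proj[symmetric]) (auto simp: set_sum_alt)
qed

lemma sum_component:
  assumes "\<And>j. j \<in> {1..m} \<Longrightarrow> subspace (A j) \<and> A j \<subseteq> cyc (u j)" "j \<in> {1..m}"
  shows "(\<Sum>i\<in>{1..m}. A i) \<inter> cyc (u j) = A j"
proof -
  have "x \<in> (\<Sum>i\<in>{1..m}. A i) \<longleftrightarrow> x \<in> A j" if x: "x \<in> cyc (u j)" for x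
    using assms x subspace_0
    by (subst mem_sum_iff) (auto simp: proj_component[OF assms(2) x])
  then show ?thesis using assms by blast
qed

lemma subspace_sum_components:
  assumes "\<And>j. j \<in> {1..m} \<Longrightarrow> subspace (A j) \<and> A j \<subseteq> cyc (u j)"
  shows "subspace (\<Sum>j\<in>{1..m}. A j)"
proof -
  have "(\<Sum>j\<in>{1..m}. A j) = {x. \<forall>j\<in>{1..m}. proj j x \<in> A j}"
    using mem_sum_iff[of A] assms by blast
  moreover have "subspace \<dots>"
    using assms subspace_0 subspace_add subspace_scale
    by (intro subspaceI)
      (auto simp: centralizes_add[OF centralizes_proj] centralizes_scale[OF centralizes_proj]
        centralizes_zero[OF centralizes_proj])
  ultimately show ?thesis by simp
qed

text \<open>A map is the sum of its blocks from the \<open>j\<close>-th to the \<open>i\<close>-th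
  summand, so invariance can be tested block by block.\<close>

lemma hyperinvariant_sumI:
  assumes A: "\<And>j. j \<in> {1..m} \<Longrightarrow> subspace (A j) \<and> A j \<subseteq> cyc (u j)"
    and g: "\<And>g i j x. centralizes g \<Longrightarrow> i \<in> {1..m} \<Longrightarrow> j \<in> {1..m} \<Longrightarrow> x \<in> A j \<Longrightarrow> proj i (g x) \<in> A i"
  shows "hyperinvariant scale f (\<Sum>j\<in>{1..m}. A j)"
  unfolding hyperinvariant_def
proof (intro conjI allI impI image_subsetI)
  show "subspace (\<Sum>j\<in>{1..m}. A j)" using A by (rule subspace_sum_components)
  fix h x assume h: "endomorphism scale h \<and> h \<circ> f = f \<circ> h" and x: "x \<in> (\<Sum>j\<in>{1..m}. A j)"
  then have c: "centralizes h" by (simp add: centralizes_def)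
  have "proj i (h x) \<in> A i" if i: "i \<in> {1..m}" for i
  proof -
    have "proj i (h x) = proj i (h (\<Sum>j\<in>{1..m}. proj j x))" by (simp only: sum_proj)
    also have "\<dots> = (\<Sum>j\<in>{1..m}. proj i (h (proj j x)))"
      by (simp add: centralizes_sum[OF c] centralizes_sum[OF centralizes_proj[OF i]])
    also have "\<dots> \<in> A i"
      using x A g[OF c i] i mem_sum_iff[of A] by (intro subspace_sum) blast+
    finally show ?thesis .
  qed
  then show "h x \<in> (\<Sum>j\<in>{1..m}. A j)" using A mem_sum_iff[of A] by blast
qed

section \<open>Hyperinvariant kernel and hull of a characteristic subspace\<close>

lemma characteristic_off_diagonal:
  assumes X: "characteristic scale f X" and g: "centralizes g"
    and ij: "i \<in> {1..m}" "j \<in> {1..m}" "i \<noteq> j" and x: "x \<in> X"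
  shows "proj i (g (proj j x)) \<in> X"
proof -
  let ?h = "proj i \<circ> g \<circ> proj j"
  have h: "centralizes ?h" using g ij by (intro centralizes_comp centralizes_proj)
  \<comment> \<open>The square contains \<open>proj j\<close> applied after \<open>proj i\<close>,
    which is 0 because \<open>i \<noteq> j\<close>.\<close>
  have nil: "(?h ^^ 2) y = 0" for y
    using ij proj_component[OF ij(1) proj_in_cyc[OF ij(1)] ij(2)]
    by (simp add: numeral_2_eq_2 centralizes_zero[OF g] centralizes_zero[OF centralizes_proj])
  show ?thesis using characteristic_nilpotent_image[OF X h nil x] by simp
qed

text \<open>As \<open>proj j\<close> commutes with \<open>f\<close>, the map
  \<open>f \<circ> proj j\<close> inherits nilpotency from \<open>f\<close>. This is what keeps
  kernel and hull within one power of \<open>f\<close> of each other in every component.\<close>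

lemma characteristic_f_proj:
  assumes X: "characteristic scale f X" and j: "j \<in> {1..m}" and x: "x \<in> X"
  shows "f (proj j x) \<in> X"
proof -
  let ?h = "f \<circ> proj j"
  have h: "centralizes ?h" using j by (intro centralizes_comp centralizes_proj centralizes_self)
  have pow: "(?h ^^ n) y = (f ^^ n) ((proj j ^^ n) y)" for n y
    by (induction n) (simp_all add: centralizes_funpow_f[OF centralizes_proj[OF j]])
  obtain n where "\<forall>x. (f ^^ n) x = 0" using nilpotent_f unfolding nilpotent_map_def by blast
  then have nil: "(?h ^^ n) y = 0" for y by (simp add: pow)
  show ?thesis using characteristic_nilpotent_image[OF X h nil x] by simp
qed

text \<open>Off-diagonal blocks preserve the components because \<open>X\<close> is characteristic;
  diagonal ones map each vector into its own cyclic subspace, which \<open>X\<close> contains by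
  \<open>f\<close>-invariance. For maximality, the projections belong to the commutant, so a
  hyperinvariant \<open>Y\<close> contains all projections of its elements.\<close>

lemma hyperinvariant_kernel_eq:
  assumes X: "characteristic scale f X"
  shows "hyperinvariant_kernel scale f X = (\<Sum>j\<in>{1..m}. cyc (u j) \<inter> X)"
  unfolding hyperinvariant_kernel_def
proof (rule Greatest_equality)
  have sub: "subspace X" and inv: "f ` X \<subseteq> X" using X by (auto simp: characteristic_def)
  let ?A = "\<lambda>j. cyc (u j) \<inter> X"
  have A: "subspace (?A j) \<and> ?A j \<subseteq> cyc (u j)" for j
    using sub by (simp add: subspace_inter subspace_cyc)
  have "hyperinvariant scale f (\<Sum>j\<in>{1..m}. ?A j)"
  proof (rule hyperinvariant_sumI)
    show "subspace (?A j) \<and> ?A j \<subseteq> cyc (u j)" for j by (rule A)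
    fix g i j x assume g: "centralizes g" and ij: "i \<in> {1..m}" "j \<in> {1..m}" and x: "x \<in> ?A j"
    have px: "proj j x = x" using x ij(2) by (simp add: proj_component[of j])
    have "proj i (g x) \<in> X"
    proof (cases "i = j")
      case True
      have "cyc x \<subseteq> X"
      proof (rule cyc_minimal[OF sub])
        show "(f ^^ n) x \<in> X" for n using x inv by (induction n) auto
      qed
      moreover have "(proj i \<circ> g) x \<in> cyc x"
        using x ij g True
        by (intro cyclic_endomorphism_image[of x "u j"] centralizes_comp centralizes_proj)
          (auto simp: proj_in_cyc)
      ultimately show ?thesis by auto
    next
      case False
      then show ?thesis using characteristic_off_diagonal[OF X g ij False, of x] px x by simp
    qed
    then show "proj i (g x) \<in> ?A i" using ij by (simp add: proj_in_cyc)
  qed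
  moreover have "(\<Sum>j\<in>{1..m}. ?A j) \<subseteq> X"
    by (auto simp: set_sum_alt intro!: subspace_sum[OF sub])
  ultimately show "hyperinvariant scale f (\<Sum>j\<in>{1..m}. ?A j) \<and> (\<Sum>j\<in>{1..m}. ?A j) \<subseteq> X" ..
  fix Y assume Y: "hyperinvariant scale f Y \<and> Y \<subseteq> X"
  have "proj j y \<in> ?A j" if "y \<in> Y" "j \<in> {1..m}" for y j
    using Y that centralizes_proj[of j] proj_in_cyc[of j y]
    unfolding hyperinvariant_def centralizes_def by blast
  then show "Y \<subseteq> (\<Sum>j\<in>{1..m}. ?A j)" using mem_sum_iff[of ?A] by blast
qed

lemma hyperinvariant_hull_eq:
  assumes X: "characteristic scale f X"
  shows "hyperinvariant_hull scale f X = (\<Sum>j\<in>{1..m}. proj j ` X)"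
  unfolding hyperinvariant_hull_def
proof (rule Least_equality)
  have sub: "subspace X" and inv: "f ` X \<subseteq> X" using X by (auto simp: characteristic_def)
  let ?A = "\<lambda>j. proj j ` X"
  have A: "subspace (?A j) \<and> ?A j \<subseteq> cyc (u j)" if "j \<in> {1..m}" for j
    using that sub proj_in_cyc
      self.linear_subspace_image[OF centralizes_linear[OF centralizes_proj[of j]]] by auto
  have "hyperinvariant scale f (\<Sum>j\<in>{1..m}. ?A j)"
  proof (rule hyperinvariant_sumI)
    show "subspace (?A j) \<and> ?A j \<subseteq> cyc (u j)" if "j \<in> {1..m}" for j using that by (rule A)
    fix g i j y assume g: "centralizes g" and ij: "i \<in> {1..m}" "j \<in> {1..m}" and y: "y \<in> ?A j"
    then obtain x where x: "y = proj j x" "x \<in> X" by blast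
    show "proj i (g y) \<in> ?A i"
    proof (cases "i = j")
      case True
      have fX: "(f ^^ n) x \<in> X" for n using x inv by (induction n) auto
      have "cyc y \<subseteq> ?A j"
      proof (rule cyc_minimal)
        show "subspace (?A j)" using A ij by blast
        show "(f ^^ n) y \<in> ?A j" for n
          using fX[of n] by (simp add: x centralizes_funpow_f[OF centralizes_proj[OF ij(2)], symmetric])
      qed
      moreover have "(proj i \<circ> g) y \<in> cyc y"
        using x ij g True
        by (intro cyclic_endomorphism_image[of y "u j"] centralizes_comp centralizes_proj)
          (auto simp: proj_in_cyc)
      ultimately show ?thesis using True by auto
    next
      case False
      \<comment> \<open>The value lies in \<open>X\<close> and in the \<open>i\<close>-th summand,
        so it is its own \<open>i\<close>-th projection.\<close>
      then have "proj i (g y) \<in> X" using characteristic_off_diagonal[OF X g ij] x by simp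
      moreover have "proj i (proj i (g y)) = proj i (g y)"
        using ij(1) by (simp add: proj_component[of i] proj_in_cyc)
      ultimately show ?thesis by (intro image_eqI[of _ _ "proj i (g y)"]) simp_all
    qed
  qed
  moreover have "X \<subseteq> (\<Sum>j\<in>{1..m}. ?A j)" using A mem_sum_iff[of ?A] by blast
  ultimately show "hyperinvariant scale f (\<Sum>j\<in>{1..m}. ?A j) \<and> X \<subseteq> (\<Sum>j\<in>{1..m}. ?A j)" ..
  fix Y assume Y: "hyperinvariant scale f Y \<and> X \<subseteq> Y"
  then have "?A j \<subseteq> Y" if "j \<in> {1..m}" for j
    using that centralizes_proj[of j] unfolding hyperinvariant_def centralizes_def by blast
  moreover have "subspace Y" using Y by (simp add: hyperinvariant_def)
  ultimately have "sum v {1..m} \<in> Y" if "\<And>j. j \<in> {1..m} \<Longrightarrow> v j \<in> ?A j" for v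
    using that by (intro subspace_sum) blast+
  then show "(\<Sum>j\<in>{1..m}. ?A j) \<subseteq> Y" by (auto simp: set_sum_alt)
qed

section \<open>The subspaces \<open>W\<close> in terms of generators\<close>

lemma cyc_fpow_component: "subspace (cyc ((f ^^ n) x)) \<and> cyc ((f ^^ n) x) \<subseteq> cyc x"
  by (simp add: subspace_cyc cyc_subset fpow_in_cyc)

lemma tuple_lattice_mono:
  assumes "r \<in> tuple_lattice m t" "1 \<le> i" "i \<le> j" "j \<le> m"
  shows "r i \<le> r j \<and> t i - r i \<le> t j - r j"
  using assms(3,4)
proof (induction j rule: dec_induct)
  case (step j)
  then have "r j \<le> r (Suc j) \<and> t j - r j \<le> t (Suc j) - r (Suc j)"
    using assms(1,2) by (auto simp: tuple_lattice_def)
  with step show ?case by auto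
qed simp

text \<open>For the inclusion from left to right, the \<open>i\<close>-th summand of
  \<open>W\<close> is projected to each component \<open>j\<close>. If \<open>j \<le> i\<close>,
  lying in the range of \<open>f ^^ r i\<close> suffices, as \<open>r j \<le> r i\<close>; if
  \<open>j > i\<close>, the kernel condition does, as \<open>t i - r i \<le> t j - r j\<close>. So
  each monotonicity condition of \<open>tuple_lattice\<close> settles one case.\<close>

lemma W_eq:
  assumes r: "r \<in> tuple_lattice m t"
  shows "W f m t r = (\<Sum>j\<in>{1..m}. cyc ((f ^^ r j) (u j)))"
proof (intro equalityI subsetI)
  have le: "r j \<le> t j" if "j \<in> {1..m}" for j using r that by (simp add: tuple_lattice_def)
  fix x
  assume "x \<in> (\<Sum>j\<in>{1..m}. cyc ((f ^^ r j) (u j)))"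
  then obtain v where v: "x = sum v {1..m}" "\<And>j. j \<in> {1..m} \<Longrightarrow> v j \<in> cyc ((f ^^ r j) (u j))"
    by (auto simp: set_sum_alt)
  have "v j \<in> range (f ^^ r j) \<inter> {x. (f ^^ (t j - r j)) x = 0}" if j: "j \<in> {1..m}" for j
  proof -
    have "(f ^^ n) ((f ^^ r j) (u j)) \<in> range (f ^^ r j)" for n
      by (metis add.commute fpow_fpow rangeI)
    then have "cyc ((f ^^ r j) (u j)) \<subseteq> range (f ^^ r j)"
      using self.linear_subspace_image[OF centralizes_linear[OF centralizes_funpow[OF centralizes_self]]]
      by (intro cyc_minimal) auto
    moreover have "(f ^^ (t j - r j)) ((f ^^ r j) (u j)) = 0"
      using le[OF j] j by (simp add: fpow_fpow fpow_u_eq_0)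
    ultimately show ?thesis using v(2)[OF j] cyc_funpow_eq_0 by blast
  qed
  then show "x \<in> W f m t r" using v(1) by (auto simp: W_def set_sum_alt)
next
  have le: "r j \<le> t j" if "j \<in> {1..m}" for j using r that by (simp add: tuple_lattice_def)
  let ?S = "\<Sum>j\<in>{1..m}. cyc ((f ^^ r j) (u j))"
  fix x assume "x \<in> W f m t r"
  then obtain v where v: "x = sum v {1..m}"
    "\<And>i. i \<in> {1..m} \<Longrightarrow> v i \<in> range (f ^^ r i) \<inter> {x. (f ^^ (t i - r i)) x = 0}"
    by (auto simp: W_def set_sum_alt)
  have "proj j (v i) \<in> cyc ((f ^^ r j) (u j))" if i: "i \<in> {1..m}" and j: "j \<in> {1..m}" for i j
  proof (cases "j \<le> i")
    case True
    obtain z where "v i = (f ^^ r i) z" using v(2)[OF i] by blast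
    then have eq: "proj j (v i) = (f ^^ r i) (proj j z)"
      by (simp add: centralizes_funpow_f[OF centralizes_proj[OF j]])
    \<comment> \<open>Writing \<open>proj j z\<close> as a polynomial in \<open>f\<close> applied to
      \<open>u j\<close> lets \<open>f ^^ r i\<close> move onto the generator.\<close>
    obtain q where q: "proj j z = q (u j)" "bicentralizes q" "\<forall>y. q y \<in> cyc y"
      using cyc_endomorphism[OF proj_in_cyc[OF j]] .
    have "proj j (v i) = q ((f ^^ r i) (u j))"
      unfolding eq q(1) by (simp add: centralizes_funpow_f[OF bicentralizes_centralizes[OF q(2)]])
    then have "proj j (v i) \<in> cyc ((f ^^ r i) (u j))" using q(3) by simp
    moreover have "r j \<le> r i" using tuple_lattice_mono[OF r, of j i] True i j by simp
    ultimately show ?thesis using cyc_fpow_mono by blast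
  next
    case False
    have "(f ^^ (t i - r i)) (v i) = 0" using v(2)[OF i] by blast
    then have "(f ^^ (t i - r i)) (proj j (v i)) = 0"
      by (metis centralizes_funpow_f[OF centralizes_proj[OF j]] centralizes_zero[OF centralizes_proj[OF j]])
    moreover have "t i - r i \<le> t j - r j"
      using tuple_lattice_mono[OF r, of i j] False i j by simp
    ultimately have "(f ^^ (t j - r j)) (proj j (v i)) = 0"
      by (meson fpow_eq_0_iff le_trans)
    then show ?thesis
      using kernel_fpow_in_cyc[OF proj_in_cyc[OF j]] le[OF j] by (simp add: exponent_u[OF j])
  qed
  then have "v i \<in> ?S" if "i \<in> {1..m}" for i
    using that cyc_fpow_component by (subst mem_sum_iff) auto
  then show "x \<in> ?S"
    unfolding v(1) using cyc_fpow_component by (intro subspace_sum subspace_sum_components) auto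
qed

section \<open>Kernel and hull in coordinates\<close>

lemma sum_components_inject:
  assumes "(\<Sum>j\<in>{1..m}. A j) = (\<Sum>j\<in>{1..m}. B j)" "j \<in> {1..m}"
    and "\<And>j. j \<in> {1..m} \<Longrightarrow> subspace (A j) \<and> A j \<subseteq> cyc (u j)"
    and "\<And>j. j \<in> {1..m} \<Longrightarrow> subspace (B j) \<and> B j \<subseteq> cyc (u j)"
  shows "A j = B j"
  using sum_component[of A j] sum_component[of B j] assms by simp

text \<open>Both descriptions of the kernel are sums of subspaces of the \<open>cyc (u j)\<close>,
  and such a sum determines its summands.\<close>

lemma kernel_component:
  assumes X: "characteristic scale f X" and r: "r \<in> tuple_lattice m t"
    and eq: "hyperinvariant_kernel scale f X = W f m t r" and j: "j \<in> {1..m}"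
  shows "cyc (u j) \<inter> X = cyc ((f ^^ r j) (u j))"
proof (rule sum_components_inject[OF _ j])
  show "(\<Sum>j\<in>{1..m}. cyc (u j) \<inter> X) = (\<Sum>j\<in>{1..m}. cyc ((f ^^ r j) (u j)))"
    using eq by (simp add: hyperinvariant_kernel_eq[OF X] W_eq[OF r])
qed (use X in \<open>auto simp: cyc_fpow_component characteristic_def subspace_inter subspace_cyc\<close>)

lemma hull_component:
  assumes X: "characteristic scale f X" and \<mu>: "\<mu> \<in> tuple_lattice m t"
    and eq: "hyperinvariant_hull scale f X = W f m t \<mu>" and j: "j \<in> {1..m}"
  shows "proj j ` X = cyc ((f ^^ \<mu> j) (u j))"
proof (rule sum_components_inject[OF _ j])
  show "(\<Sum>j\<in>{1..m}. proj j ` X) = (\<Sum>j\<in>{1..m}. cyc ((f ^^ \<mu> j) (u j)))"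
    using eq by (simp add: hyperinvariant_hull_eq[OF X] W_eq[OF \<mu>])
  show "subspace (proj j ` X) \<and> proj j ` X \<subseteq> cyc (u j)" if "j \<in> {1..m}" for j
    using X that proj_in_cyc
      self.linear_subspace_image[OF centralizes_linear[OF centralizes_proj[of j]]]
    by (auto simp: characteristic_def)
qed (simp add: cyc_fpow_component)

section \<open>Maps in the commutant with a prescribed value at a generator\<close>

lemma generator_powers_independent:
  assumes j: "j \<in> {1..m}"
  shows "independent ((\<lambda>n. (f ^^ n) (u j)) ` {k..<t j})"
proof (induction "t j - k" arbitrary: k)
  case (Suc d)
  let ?p = "\<lambda>n. (f ^^ n) (u j)"
  have k: "k < t j" using Suc.hyps by simp
  have "span (?p ` {Suc k..<t j}) \<subseteq> cyc (?p (Suc k))"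
  proof (rule span_minimal[OF _ subspace_cyc])
    show "?p ` {Suc k..<t j} \<subseteq> cyc (?p (Suc k))"
    proof (rule image_subsetI)
      fix n assume "n \<in> {Suc k..<t j}"
      then have "?p n = (f ^^ (n - Suc k)) (?p (Suc k))"
        by (simp add: fpow_fpow del: funpow.simps)
      then show "?p n \<in> cyc (?p (Suc k))" using fpow_in_cyc by metis
    qed
  qed
  \<comment> \<open>The later powers lie in the cyclic subspace of \<open>?p (Suc k)\<close>, which
    cannot contain the earlier power \<open>?p k\<close>.\<close>
  then have "?p k \<notin> span (?p ` {Suc k..<t j})"
    using fpow_in_cyc_fpow[of k "u j" "Suc k"] k by (auto simp: exponent_u[OF j])
  moreover have "independent (?p ` {Suc k..<t j})" using Suc by simp
  moreover have "{k..<t j} = insert k {Suc k..<t j}" using k by auto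
  ultimately show ?case by (simp add: independent_insertI del: funpow.simps)
qed (simp add: independent_empty)

lemma generator_powers_inj:
  assumes j: "j \<in> {1..m}"
  shows "inj_on (\<lambda>n. (f ^^ n) (u j)) {..<t j}"
proof (rule inj_onI)
  fix a b assume "a \<in> {..<t j}" "b \<in> {..<t j}" "(f ^^ a) (u j) = (f ^^ b) (u j)"
  then show "a = b"
    using fpow_in_cyc_fpow[of a "u j" b] fpow_in_cyc_fpow[of b "u j" a]
      fpow_in_cyc[of 0 "(f ^^ a) (u j)"]
    by (auto simp: exponent_u[OF j])
qed

text \<open>The only relation on \<open>u j\<close> is that \<open>f ^^ t j\<close> kills it, so any
  \<open>w\<close> with this property is a possible image. The map is prescribed on the basis of
  powers of \<open>u j\<close>; composing with \<open>proj j\<close> makes it 0 on the other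
  summands.\<close>

lemma generator_map_exists:
  assumes j: "j \<in> {1..m}" and w: "(f ^^ t j) w = 0"
  obtains g where "centralizes g" "g (u j) = w"
proof -
  let ?p = "\<lambda>n. (f ^^ n) (u j)"
  have "independent (?p ` {..<t j})"
    using generator_powers_independent[OF j, of 0] by (simp add: atLeast0LessThan)
  \<comment> \<open>\<open>inv_into\<close> reads off the exponent \<open>n\<close> from the basis
    vector \<open>?p n\<close>.\<close>
  then have "\<exists>h. Vector_Spaces.linear scale scale h \<and>
      (\<forall>b\<in>?p ` {..<t j}. h b = (f ^^ inv_into {..<t j} ?p b) w)"
    by (rule self.linear_independent_extend)
  then obtain h where h: "Vector_Spaces.linear scale scale h"
    "\<forall>b\<in>?p ` {..<t j}. h b = (f ^^ inv_into {..<t j} ?p b) w"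
    by blast
  \<comment> \<open>From \<open>t j\<close> on nothing is prescribed; both sides are then 0, the
    right one by the assumption on \<open>w\<close>.\<close>
  have hp: "h (?p n) = (f ^^ n) w" for n
  proof (cases "n < t j")
    case True
    then show ?thesis using h(2) inv_into_f_f[OF generator_powers_inj[OF j]] by auto
  next
    case False
    then have "t j \<le> n" by simp
    then show ?thesis
      using w self.linear_0[OF h(1)] by (metis fpow_u_eq_0[OF j] fpow_eq_0_iff le_trans)
  qed
  have hf: "h (f y) = f (h y)" if "y \<in> cyc (u j)" for y
  proof -
    have "subspace {y. h (f y) = f (h y)}"
      by (intro subspaceI)
        (auto simp: self.linear_add[OF h(1)] self.linear_scale[OF h(1)] self.linear_0[OF h(1)]
          centralizes_add[OF centralizes_self] centralizes_scale[OF centralizes_self]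
          centralizes_zero[OF centralizes_self])
    moreover have "h (f (?p n)) = f (h (?p n))" for n using hp[of n] hp[of "Suc n"] by simp
    ultimately have "cyc (u j) \<subseteq> {y. h (f y) = f (h y)}" by (intro cyc_minimal) auto
    then show ?thesis using that by blast
  qed
  show thesis
  proof
    show "centralizes (h \<circ> proj j)"
      by (intro centralizesI)
        (simp_all add: self.linear_add[OF h(1)] self.linear_scale[OF h(1)] hf proj_in_cyc[OF j]
          centralizes_add[OF centralizes_proj[OF j]] centralizes_scale[OF centralizes_proj[OF j]]
          centralizes_f[OF centralizes_proj[OF j]])
    show "(h \<circ> proj j) (u j) = w"
      using hp[of 0] proj_component[OF j, of "u j" j] j fpow_in_cyc[of 0 "u j"] by simp
  qed
qed

section \<open>Comparison of the kernel tuple with the hull tuple\<close>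

context
  fixes X \<mu> r
  assumes X: "characteristic scale f X"
    and \<mu>: "\<mu> \<in> tuple_lattice m t" and r: "r \<in> tuple_lattice m t"
    and hull: "hyperinvariant_hull scale f X = W f m t \<mu>"
    and kernel: "hyperinvariant_kernel scale f X = W f m t r"
begin

text \<open>Turns elements found in \<open>X\<close> into upper bounds for \<open>r\<close>: such a
  power lies in the \<open>j\<close>-th component of the kernel.\<close>

lemma kernel_exponent_bound:
  assumes j: "j \<in> {1..m}" and "(f ^^ n) (u j) \<in> X"
  shows "r j \<le> n"
proof (rule fpow_in_cyc_fpow)
  show "(f ^^ n) (u j) \<in> cyc ((f ^^ r j) (u j))"
    using kernel_component[OF X r kernel j] assms fpow_in_cyc by blast
  show "r j \<le> exponent f (u j)" using r j by (simp add: exponent_u tuple_lattice_def)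
qed

lemma hull_generator_lift:
  assumes "j \<in> {1..m}"
  obtains x where "x \<in> X" "proj j x = (f ^^ \<mu> j) (u j)"
  using hull_component[OF X \<mu> hull assms] fpow_in_cyc[of 0 "(f ^^ \<mu> j) (u j)"]
  by (metis funpow_0 imageE)

text \<open>The kernel component lies in the projection, so \<open>\<mu> j \<le> r j\<close>;
  applying \<open>f \<circ> proj j\<close> to a lift of \<open>(f ^^ \<mu> j) (u j)\<close> stays in
  \<open>X\<close>, so \<open>r j \<le> \<mu> j + 1\<close>. The strict inclusion defining
  \<open>J_set\<close> decides between the two values.\<close>

lemma kernel_tuple_eq:
  assumes j: "j \<in> {1..m}"
  shows "r j = \<mu> j + (if j \<in> J_set scale f m u X then 1 else 0)"
proof -
  have cap: "cyc (u j) \<inter> X = cyc ((f ^^ r j) (u j))" by (rule kernel_component[OF X r kernel j])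
  have prj: "proj j ` X = cyc ((f ^^ \<mu> j) (u j))" by (rule hull_component[OF X \<mu> hull j])
  have "cyc (u j) \<inter> X \<subseteq> proj j ` X"
  proof
    fix x assume "x \<in> cyc (u j) \<inter> X"
    then show "x \<in> proj j ` X" using proj_component[OF j, of x j] j by (auto intro: image_eqI[of _ _ x])
  qed
  then have "\<mu> j \<le> r j"
    unfolding cap prj using fpow_in_cyc[of 0 "(f ^^ r j) (u j)"] \<mu> j
    by (intro fpow_in_cyc_fpow[of "r j" "u j" "\<mu> j"])
      (auto simp: exponent_u tuple_lattice_def)
  moreover have "r j \<le> Suc (\<mu> j)"
  proof -
    obtain x where "x \<in> X" "proj j x = (f ^^ \<mu> j) (u j)" using hull_generator_lift[OF j] .
    then have "(f ^^ Suc (\<mu> j)) (u j) \<in> X" using characteristic_f_proj[OF X j, of x] by simp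
    then show ?thesis by (rule kernel_exponent_bound[OF j])
  qed
  moreover have "j \<in> J_set scale f m u X \<longleftrightarrow> cyc ((f ^^ r j) (u j)) \<subset> cyc ((f ^^ \<mu> j) (u j))"
    using j by (simp add: J_set_def cap prj)
  moreover have "cyc ((f ^^ r j) (u j)) \<noteq> cyc ((f ^^ \<mu> j) (u j))" if "\<mu> j < r j"
  proof
    assume "cyc ((f ^^ r j) (u j)) = cyc ((f ^^ \<mu> j) (u j))"
    then have "(f ^^ \<mu> j) (u j) \<in> cyc ((f ^^ r j) (u j))"
      using fpow_in_cyc[of 0 "(f ^^ \<mu> j) (u j)"] by simp
    then have "r j \<le> \<mu> j"
      using r j by (intro fpow_in_cyc_fpow[of "\<mu> j" "u j" "r j"])
        (auto simp: exponent_u tuple_lattice_def)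
    with that show False by simp
  qed
  ultimately show ?thesis
    using cyc_fpow_mono[of "\<mu> j" "r j" "u j"] by (cases "r j = \<mu> j") auto
qed

text \<open>A lift of \<open>(f ^^ \<mu> j) (u j)\<close> to \<open>X\<close> is moved to the
  \<open>i\<close>-th summand by a map sending \<open>u j\<close> to the lowest admissible power of
  \<open>u i\<close>. The truncated difference \<open>t i - t j\<close> is that power, whichever of
  the two exponents is larger.\<close>

lemma kernel_hull_bound:
  assumes i: "i \<in> {1..m}" and j: "j \<in> {1..m}" and "i \<noteq> j"
  shows "r i \<le> \<mu> j + (t i - t j)"
proof -
  let ?w = "(f ^^ (t i - t j)) (u i)"
  have "(f ^^ t j) ?w = 0" using i by (simp add: fpow_fpow fpow_u_eq_0)
  then obtain g where g: "centralizes g" "g (u j) = ?w" using generator_map_exists[OF j] by blast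
  obtain x where x: "x \<in> X" "proj j x = (f ^^ \<mu> j) (u j)" using hull_generator_lift[OF j] .
  have "g (proj j x) = (f ^^ (\<mu> j + (t i - t j))) (u i)"
    by (simp add: x(2) centralizes_funpow_f[OF g(1)] g(2) fpow_fpow)
  then have "proj i (g (proj j x)) = (f ^^ (\<mu> j + (t i - t j))) (u i)"
    using i by (simp add: proj_component fpow_in_cyc)
  then have "(f ^^ (\<mu> j + (t i - t j))) (u i) \<in> X"
    using characteristic_off_diagonal[OF X g(1) i j \<open>i \<noteq> j\<close> x(1)] by simp
  then show ?thesis by (rule kernel_exponent_bound[OF i])
qed

text \<open>With \<open>r = \<mu> + 1\<close> at \<open>a\<close> and \<open>b\<close>, the bound
  for \<open>(a, b)\<close> reads \<open>\<mu> a + 1 \<le> \<mu> b\<close>, as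
  \<open>t a - t b\<close> truncates to 0, and that for \<open>(b, a)\<close> reads
  \<open>\<mu> b + 1 \<le> \<mu> a + (t b - t a)\<close>. Adding them yields
  \<open>t b - t a \<ge> 2\<close>.\<close>

lemma J_set_gaps:
  assumes a: "a \<in> J_set scale f m u X" and b: "b \<in> J_set scale f m u X"
    and "a \<noteq> b" "t a \<le> t b"
  shows "\<mu> a < \<mu> b" "t a - \<mu> a < t b - \<mu> b" "t a + 1 < t b"
proof -
  have m: "a \<in> {1..m}" "b \<in> {1..m}" using a b by (auto simp: J_set_def)
  have ra: "r a = \<mu> a + 1" and rb: "r b = \<mu> b + 1" using kernel_tuple_eq m a b by auto
  \<comment> \<open>Together with \<open>r = \<mu> + 1\<close> this makes the differences
    \<open>t - \<mu>\<close> genuine.\<close>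
  have le: "r a \<le> t a" "r b \<le> t b" using r m by (auto simp: tuple_lattice_def)
  show 1: "\<mu> a < \<mu> b" using kernel_hull_bound[OF m \<open>a \<noteq> b\<close>] assms(4) ra by simp
  have "\<mu> b + 1 \<le> \<mu> a + (t b - t a)" using kernel_hull_bound[of b a] m assms(3) rb by simp
  then show "t a - \<mu> a < t b - \<mu> b" "t a + 1 < t b" using 1 assms(4) le ra rb by linarith+
qed

end

end


section \<open>The relations along the increasing enumeration of \<open>J\<close>\<close>

theorem theorem2p5:
  fixes scale :: "bit \<Rightarrow> 'v::ab_group_add \<Rightarrow> 'v"
    and Basis X :: "'v set"
    and f :: "'v \<Rightarrow> 'v"
    and m k :: nat
    and t \<mu> r i :: "nat \<Rightarrow> nat"
    and u :: "nat \<Rightarrow> 'v"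
    and J :: "nat set"
  assumes V: "finite_dimensional_vector_space scale Basis"
    and f_linear: "Vector_Spaces.linear scale scale f"
    and f_nilpotent: "nilpotent_map f"
    and t_pos: "\<forall>j\<in>{1..m}. 0 < t j"
    and t_mono: "\<forall>j\<in>{1..<m}. t j \<le> t (Suc j)"
    and elem_div: "elementary_divisors scale f m (\<lambda>j. monom 1 (t j))"
    and U: "generator_tuple scale f m t u"
    and mu: "\<mu> \<in> tuple_lattice m t"
    and r: "r \<in> tuple_lattice m t"
    and J_enum: "J = i ` {1..k}"
    and i_strict: "\<forall>s\<in>{1..<k}. i s < i (Suc s)"
    and J_unrep: "J \<subseteq> unrepeated m t"
    and J_card: "card J \<ge> 2"
    and X_char: "characteristic scale f X"
    and X_not_hyper: "\<not> hyperinvariant scale f X"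
    and X_J: "J_set scale f m u X = J"
    and X_hull: "hyperinvariant_hull scale f X = W f m t \<mu>"
    and X_kernel: "hyperinvariant_kernel scale f X = W f m t r"
  shows "(\<forall>j\<in>{1..m}. r j = \<mu> j + (\<Sum>s\<in>{1..k}. unit_tuple (i s) j)) \<and>
         0 \<le> \<mu> (i 1) \<and>
         (\<forall>s\<in>{1..<k}. \<mu> (i s) < \<mu> (i (Suc s))) \<and>
         0 < t (i 1) - \<mu> (i 1) \<and>
         (\<forall>s\<in>{1..<k}. t (i s) - \<mu> (i s) < t (i (Suc s)) - \<mu> (i (Suc s))) \<and>
         (\<forall>s\<in>{1..<k}. t (i s) + 1 < t (i (Suc s)))"
proof -
  interpret generated_space scale Basis f m t u
    by (intro generated_space.intro nilpotent_space.intro nilpotent_space_axioms.intro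
        generated_space_axioms.intro V f_linear f_nilpotent U)
  note ctx = X_char mu r X_hull X_kernel
  have i_less: "i a < i b" if "1 \<le> a" "a < b" "b \<le> k" for a b
  proof -
    have "Suc a \<le> b" using that(2) by simp
    then show ?thesis using that(3)
    proof (induction b rule: dec_induct)
      case base
      then show ?case using i_strict that(1) by simp
    next
      case (step b)
      have "i b < i (Suc b)" using i_strict that(1) step by simp
      with step show ?case by simp
    qed
  qed
  then have inj: "inj_on i {1..k}"
    by (intro linorder_inj_onI') (metis atLeastAtMost_iff less_irrefl)
  have "k \<ge> 2" using J_card card_image[OF inj] by (simp add: J_enum)
  have iJ: "i s \<in> J" if "s \<in> {1..k}" for s using that by (simp add: J_enum)
  have im: "i s \<in> {1..m}" if "s \<in> {1..k}" for s
    using iJ[OF that] X_J by (auto simp: J_set_def)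
  have gaps: "\<mu> (i s) < \<mu> (i (Suc s)) \<and> t (i s) - \<mu> (i s) < t (i (Suc s)) - \<mu> (i (Suc s)) \<and>
      t (i s) + 1 < t (i (Suc s))" if s: "s \<in> {1..<k}" for s
  proof -
    have lt: "i s < i (Suc s)" using i_strict s by simp
    have bounds: "1 \<le> i s" "i (Suc s) \<le> m" using im[of s] im[of "Suc s"] s by auto
    \<comment> \<open>Orders the exponents as the indices are ordered, which
      \<open>J_set_gaps\<close> requires.\<close>
    have "t a \<le> t b" if "1 \<le> a" "a \<le> b" "b \<le> m" for a b
      using that(2,3)
    proof (induction b rule: dec_induct)
      case (step b)
      then have "t b \<le> t (Suc b)" using t_mono that(1) by simp
      with step show ?case by simp
    qed simp
    then have "t (i s) \<le> t (i (Suc s))" using lt bounds by simp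
    then show ?thesis
      using J_set_gaps[OF ctx, of "i s" "i (Suc s)"] iJ[of s] iJ[of "Suc s"] s lt X_J by simp
  qed
  \<comment> \<open>Injectivity of \<open>i\<close> ensures that no unit tuple is counted
    twice.\<close>
  have "(\<Sum>s\<in>{1..k}. unit_tuple (i s) j) = (if j \<in> J then 1 else 0)" for j
  proof -
    have "(\<Sum>s\<in>{1..k}. unit_tuple (i s) j) = (\<Sum>l\<in>J. unit_tuple l j)"
      unfolding J_enum by (simp only: sum.reindex[OF inj] comp_def)
    then show ?thesis by (simp add: unit_tuple_def J_enum)
  qed
  then have sum: "\<forall>j\<in>{1..m}. r j = \<mu> j + (\<Sum>s\<in>{1..k}. unit_tuple (i s) j)"
    using kernel_tuple_eq[OF ctx] X_J by simp
  have 1: "1 \<in> {1..k}" using \<open>k \<ge> 2\<close> by simp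
  \<comment> \<open>As \<open>i 1\<close> lies in \<open>J\<close>, \<open>r\<close> exceeds
    \<open>\<mu>\<close> there by one, and \<open>r \<le> t\<close> then makes
    \<open>t - \<mu>\<close> positive.\<close>
  have "r (i 1) = \<mu> (i 1) + 1" using kernel_tuple_eq[OF ctx im[OF 1]] iJ[OF 1] X_J by simp
  moreover have "r (i 1) \<le> t (i 1)" using r im[OF 1] by (simp add: tuple_lattice_def)
  ultimately have "0 < t (i 1) - \<mu> (i 1)" by simp
  with sum gaps show ?thesis by blast
qed

end
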